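(* For every left-symmetric algebra $(A,\circ)$ over a field $\Bbbk$, the space $T(A)=A\oplus A^{\otimes2}\oplus A^{\otimes3}\oplus\dots$ equipped with the bilinear operations $\vdash$ and $\dashv$ given by $$u\vdash a=M(u)\circ a,\qquad u\vdash(wa)=(u\vdash w)a+w(M(u)\circ a)-wM(u)a,\qquad u\dashv w=uM(w)$$ for $u,w\in T(A)$, $a\in A$, is a left-symmetric dialgebra.
   Context: $\Bbbk$ is an arbitrary field. A left-symmetric algebra is a linear space with a bilinear operation $\circ$ satisfying $(a,b,c)=(b,a,c)$, where $(a,b,c)=(a\circ b)\circ c-a\circ(b\circ c)$. $T(A)$ is the associative tensor algebra of the space $A$ without identity; juxtaposition denotes its multiplication, so $a_1\dots a_n$ means $a_1\otimes\dots\otimes a_n$. The linear map $M:T(A)\to A$ is $M(a_1\dots a_n)=((\dots((a_1\circ a_2)\circ a_3)\circ\dots)\circ a_n)$ for $a_i\in A$ (so $M(a)=a$ for $a\in A$). The operation $\vdash$ is defined by induction on the length of the second factor. A left-symmetric dialgebra is a linear space with two bilinear operations $\vdash,\dashv$ such that for all $x_1,x_2,x_3$: $(x_1\dashv x_2)\vdash x_3=(x_1\vdash x_2)\vdash x_3$; $\;x_1\dashv(x_2\vdash x_3)=x_1\dashv(x_2\dashv x_3)$; $(x_1\dashv x_2)\dashv x_3-x_1\dashv(x_2\dashv x_3)=(x_2\vdash x_1)\dashv x_3-x_2\vdash(x_1\dashv x_3)$; $(x_1\vdash x_2)\vdash x_3-x_1\vdash(x_2\vdash x_3)=(x_2\vdash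 x_1)\vdash x_3-x_2\vdash(x_1\vdash x_3)$. *)

theory Defs
  imports Complex_Main "HOL-Library.Poly_Mapping"
begin

section \<open>Left-symmetric algebras\<close>

locale left_symmetric_algebra = vector_space scale
  for scale :: "'k::field \<Rightarrow> 'a::ab_group_add \<Rightarrow> 'a" +
  fixes circ :: "'a \<Rightarrow> 'a \<Rightarrow> 'a" (infixl "\<circ>\<^sub>A" 70)
  assumes linear_right: "Vector_Spaces.linear scale scale (\<lambda>b. a \<circ>\<^sub>A b)"
    and linear_left: "Vector_Spaces.linear scale scale (\<lambda>a. a \<circ>\<^sub>A b)"
    and left_symmetric:
      "(a \<circ>\<^sub>A b) \<circ>\<^sub>A c - a \<circ>\<^sub>A (b \<circ>\<^sub>A c) = (b \<circ>\<^sub>A a) \<circ>\<^sub>A c - b \<circ>\<^sub>A (a \<circ>\<^sub>A c)"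


section \<open>Left-symmetric dialgebras\<close>

text \<open>
  The tensor algebra of a vector space \<open>A\<close> depends on the scalar multiplication of \<open>A\<close>, so its
  elements form a set rather than a type. Vector spaces and dialgebras are therefore given
  here relative to a carrier set; outside the carrier the operations are unconstrained.
\<close>

locale vector_space_on =
  fixes V :: "'v set"
    and add :: "'v \<Rightarrow> 'v \<Rightarrow> 'v" (infixl "\<oplus>" 65)
    and zero :: 'v ("\<zero>")
    and smult :: "'k::field \<Rightarrow> 'v \<Rightarrow> 'v" (infixr "\<odot>" 75)
  assumes add_closed: "\<lbrakk>x \<in> V; y \<in> V\<rbrakk> \<Longrightarrow> x \<oplus> y \<in> V"
    and zero_closed: "\<zero> \<in> V"
    and smult_closed: "x \<in> V \<Longrightarrow> c \<odot> x \<in> V"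
    and add_assoc: "\<lbrakk>x \<in> V; y \<in> V; z \<in> V\<rbrakk> \<Longrightarrow> (x \<oplus> y) \<oplus> z = x \<oplus> (y \<oplus> z)"
    and add_commute: "\<lbrakk>x \<in> V; y \<in> V\<rbrakk> \<Longrightarrow> x \<oplus> y = y \<oplus> x"
    and add_zero: "x \<in> V \<Longrightarrow> x \<oplus> \<zero> = x"
    and add_inverse: "x \<in> V \<Longrightarrow> \<exists>y\<in>V. x \<oplus> y = \<zero>"
    and smult_add_right: "\<lbrakk>x \<in> V; y \<in> V\<rbrakk> \<Longrightarrow> c \<odot> (x \<oplus> y) = c \<odot> x \<oplus> c \<odot> y"
    and smult_add_left: "x \<in> V \<Longrightarrow> (c + d) \<odot> x = c \<odot> x \<oplus> d \<odot> x"
    and smult_assoc: "x \<in> V \<Longrightarrow> c \<odot> (d \<odot> x) = (c * d) \<odot> x"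
    and smult_one: "x \<in> V \<Longrightarrow> 1 \<odot> x = x"

definition bilinear_on ::
    "'v set \<Rightarrow> ('v \<Rightarrow> 'v \<Rightarrow> 'v) \<Rightarrow> ('k \<Rightarrow> 'v \<Rightarrow> 'v) \<Rightarrow> ('v \<Rightarrow> 'v \<Rightarrow> 'v) \<Rightarrow> bool" where
  "bilinear_on V add smult f \<longleftrightarrow>
     (\<forall>x\<in>V. \<forall>y\<in>V. f x y \<in> V) \<and>
     (\<forall>x\<in>V. \<forall>y\<in>V. \<forall>z\<in>V. f x (add y z) = add (f x y) (f x z)) \<and>
     (\<forall>x\<in>V. \<forall>y\<in>V. \<forall>z\<in>V. f (add x y) z = add (f x z) (f y z)) \<and>
     (\<forall>c. \<forall>x\<in>V. \<forall>y\<in>V. f x (smult c y) = smult c (f x y)) \<and>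
     (\<forall>c. \<forall>x\<in>V. \<forall>y\<in>V. f (smult c x) y = smult c (f x y))"

locale left_symmetric_dialgebra = vector_space_on V add zero smult
  for V :: "'v set"
    and add :: "'v \<Rightarrow> 'v \<Rightarrow> 'v" (infixl "\<oplus>" 65)
    and zero :: 'v ("\<zero>")
    and smult :: "'k::field \<Rightarrow> 'v \<Rightarrow> 'v" (infixr "\<odot>" 75) +
  fixes vdash :: "'v \<Rightarrow> 'v \<Rightarrow> 'v" (infixl "\<turnstile>" 70)
    and dashv :: "'v \<Rightarrow> 'v \<Rightarrow> 'v" (infixl "\<stileturn>" 70)
  assumes bilinear_vdash: "bilinear_on V (\<oplus>) (\<odot>) (\<turnstile>)"
    and bilinear_dashv: "bilinear_on V (\<oplus>) (\<odot>) (\<stileturn>)"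
    and left_bar: "\<lbrakk>x \<in> V; y \<in> V; z \<in> V\<rbrakk> \<Longrightarrow> (x \<stileturn> y) \<turnstile> z = (x \<turnstile> y) \<turnstile> z"
    and right_bar: "\<lbrakk>x \<in> V; y \<in> V; z \<in> V\<rbrakk> \<Longrightarrow> x \<stileturn> (y \<turnstile> z) = x \<stileturn> (y \<stileturn> z)"
    and left_symmetric_dashv: "\<lbrakk>x \<in> V; y \<in> V; z \<in> V\<rbrakk> \<Longrightarrow>
      (x \<stileturn> y) \<stileturn> z \<oplus> (-1) \<odot> (x \<stileturn> (y \<stileturn> z)) =
      (y \<turnstile> x) \<stileturn> z \<oplus> (-1) \<odot> (y \<turnstile> (x \<stileturn> z))"
    and left_symmetric_vdash: "\<lbrakk>x \<in> V; y \<in> V; z \<in> V\<rbrakk> \<Longrightarrow>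
      (x \<turnstile> y) \<turnstile> z \<oplus> (-1) \<odot> (x \<turnstile> (y \<turnstile> z)) =
      (y \<turnstile> x) \<turnstile> z \<oplus> (-1) \<odot> (y \<turnstile> (x \<turnstile> z))"


section \<open>The tensor algebra without identity\<close>

text \<open>
  \<open>T(A)\<close> is built as the free vector space on the nonempty words over \<open>A\<close> modulo the subspace
  spanned by the multilinearity relations in each letter. Finitely supported functions on
  words represent formal linear combinations.
\<close>

definition free_scale :: "'k::field \<Rightarrow> ('w \<Rightarrow>\<^sub>0 'k) \<Rightarrow> ('w \<Rightarrow>\<^sub>0 'k)" where
  "free_scale c p = Poly_Mapping.map (\<lambda>d. c * d) p"

lemma lookup_free_scale [simp]:
  "Poly_Mapping.lookup (free_scale c p) w = c * Poly_Mapping.lookup p w"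
  by (simp add: free_scale_def Poly_Mapping.map.rep_eq when_def)

lemma vector_space_free_scale: "vector_space (free_scale :: 'k::field \<Rightarrow> ('w \<Rightarrow>\<^sub>0 'k) \<Rightarrow> _)"
  by unfold_locales (auto intro!: poly_mapping_eqI simp: lookup_add algebra_simps)

definition free_word :: "'a list \<Rightarrow> ('a list \<Rightarrow>\<^sub>0 'k::field)" where
  "free_word xs = Poly_Mapping.single xs 1"

definition free_mult ::
    "('a list \<Rightarrow>\<^sub>0 'k::field) \<Rightarrow> ('a list \<Rightarrow>\<^sub>0 'k) \<Rightarrow> ('a list \<Rightarrow>\<^sub>0 'k)" where
  "free_mult p q = (\<Sum>xs\<in>Poly_Mapping.keys p. \<Sum>ys\<in>Poly_Mapping.keys q.
     Poly_Mapping.single (xs @ ys) (Poly_Mapping.lookup p xs * Poly_Mapping.lookup q ys))"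

definition free_space :: "('a list \<Rightarrow>\<^sub>0 'k::field) set" where
  "free_space = {p. [] \<notin> Poly_Mapping.keys p}"

definition multilinear_relators ::
    "('k::field \<Rightarrow> 'a::ab_group_add \<Rightarrow> 'a) \<Rightarrow> ('a list \<Rightarrow>\<^sub>0 'k) set" where
  "multilinear_relators scale =
     {free_word (xs @ [a + b] @ ys) - free_word (xs @ [a] @ ys) - free_word (xs @ [b] @ ys)
        | xs ys a b. True} \<union>
     {free_word (xs @ [scale c a] @ ys) - free_scale c (free_word (xs @ [a] @ ys))
        | xs ys c a. True}"

definition tensor_rel ::
    "('k::field \<Rightarrow> 'a::ab_group_add \<Rightarrow> 'a) \<Rightarrow> (('a list \<Rightarrow>\<^sub>0 'k) \<times> ('a list \<Rightarrow>\<^sub>0 'k)) set" where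
  "tensor_rel scale =
     {(p, q). p \<in> free_space \<and> q \<in> free_space \<and>
        p - q \<in> module.span free_scale (multilinear_relators scale)}"

type_synonym ('a, 'k) tensor = "('a list \<Rightarrow>\<^sub>0 'k) set"

definition tensor_class ::
    "('k::field \<Rightarrow> 'a::ab_group_add \<Rightarrow> 'a) \<Rightarrow> ('a list \<Rightarrow>\<^sub>0 'k) \<Rightarrow> ('a, 'k) tensor" where
  "tensor_class scale p = tensor_rel scale `` {p}"

definition tensor_space ::
    "('k::field \<Rightarrow> 'a::ab_group_add \<Rightarrow> 'a) \<Rightarrow> ('a, 'k) tensor set" where
  "tensor_space scale = free_space // tensor_rel scale"

text \<open>
  The unions below range over the representatives of the arguments; all representatives
  contribute the same class.
\<close>

definition tensor_add ::
    "('k::field \<Rightarrow> 'a::ab_group_add \<Rightarrow> 'a) \<Rightarrow>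
      ('a, 'k) tensor \<Rightarrow> ('a, 'k) tensor \<Rightarrow> ('a, 'k) tensor" where
  "tensor_add scale X Y = (\<Union>p\<in>X. \<Union>q\<in>Y. tensor_class scale (p + q))"

definition tensor_zero ::
    "('k::field \<Rightarrow> 'a::ab_group_add \<Rightarrow> 'a) \<Rightarrow> ('a, 'k) tensor" where
  "tensor_zero scale = tensor_class scale 0"

definition tensor_scale ::
    "('k::field \<Rightarrow> 'a::ab_group_add \<Rightarrow> 'a) \<Rightarrow> 'k \<Rightarrow> ('a, 'k) tensor \<Rightarrow> ('a, 'k) tensor" where
  "tensor_scale scale c X = (\<Union>p\<in>X. tensor_class scale (free_scale c p))"

definition tensor_mult ::
    "('k::field \<Rightarrow> 'a::ab_group_add \<Rightarrow> 'a) \<Rightarrow>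
      ('a, 'k) tensor \<Rightarrow> ('a, 'k) tensor \<Rightarrow> ('a, 'k) tensor" where
  "tensor_mult scale X Y = (\<Union>p\<in>X. \<Union>q\<in>Y. tensor_class scale (free_mult p q))"

text \<open>
  For nonempty \<open>xs = [a\<^sub>1, \<dots>, a\<^sub>n]\<close> this is the decomposable tensor
  \<open>a\<^sub>1 \<otimes> \<dots> \<otimes> a\<^sub>n\<close>; in particular \<open>a \<mapsto> tensor_word scale [a]\<close> embeds \<open>A\<close> into \<open>T(A)\<close>.
\<close>

definition tensor_word ::
    "('k::field \<Rightarrow> 'a::ab_group_add \<Rightarrow> 'a) \<Rightarrow> 'a list \<Rightarrow> ('a, 'k) tensor" where
  "tensor_word scale xs = tensor_class scale (free_word xs)"


section \<open>The operations on the tensor algebra of a left-symmetric algebra\<close>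

text \<open>
  \<open>M\<close> is the linear map determined by its values on decomposable tensors, and \<open>\<turnstile>\<close> the bilinear
  operation determined by its recursion on the length of the second factor.
\<close>

locale tensor_operations =
  fixes scale :: "'k::field \<Rightarrow> 'a::ab_group_add \<Rightarrow> 'a"
    and circ :: "'a \<Rightarrow> 'a \<Rightarrow> 'a" (infixl "\<circ>\<^sub>A" 70)
    and M :: "('a, 'k) tensor \<Rightarrow> 'a"
    and vdash :: "('a, 'k) tensor \<Rightarrow> ('a, 'k) tensor \<Rightarrow> ('a, 'k) tensor" (infixl "\<turnstile>" 70)
    and dashv :: "('a, 'k) tensor \<Rightarrow> ('a, 'k) tensor \<Rightarrow> ('a, 'k) tensor" (infixl "\<stileturn>" 70)
    and T :: "('a, 'k) tensor set"
    and add :: "('a, 'k) tensor \<Rightarrow> ('a, 'k) tensor \<Rightarrow> ('a, 'k) tensor" (infixl "\<oplus>" 65)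
    and smult :: "'k \<Rightarrow> ('a, 'k) tensor \<Rightarrow> ('a, 'k) tensor" (infixr "\<odot>" 75)
    and mult :: "('a, 'k) tensor \<Rightarrow> ('a, 'k) tensor \<Rightarrow> ('a, 'k) tensor" (infixl "\<cdot>" 72)
    and embed :: "'a \<Rightarrow> ('a, 'k) tensor" ("\<iota>")
  defines "T \<equiv> tensor_space scale"
    and "add \<equiv> tensor_add scale"
    and "smult \<equiv> tensor_scale scale"
    and "mult \<equiv> tensor_mult scale"
    and "embed \<equiv> \<lambda>a. tensor_word scale [a]"
  assumes M_add: "\<lbrakk>u \<in> T; v \<in> T\<rbrakk> \<Longrightarrow> M (u \<oplus> v) = M u + M v"
    and M_smult: "u \<in> T \<Longrightarrow> M (c \<odot> u) = scale c (M u)"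
    and M_word: "M (tensor_word scale (a # as)) = foldl (\<circ>\<^sub>A) a as"
    and vdash_bilinear: "bilinear_on T (\<oplus>) (\<odot>) (\<turnstile>)"
    and vdash_letter: "u \<in> T \<Longrightarrow> u \<turnstile> \<iota> a = \<iota> (M u \<circ>\<^sub>A a)"
    and vdash_mult_letter: "\<lbrakk>u \<in> T; w \<in> T\<rbrakk> \<Longrightarrow>
      u \<turnstile> (w \<cdot> \<iota> a) = (u \<turnstile> w) \<cdot> \<iota> a \<oplus> w \<cdot> \<iota> (M u \<circ>\<^sub>A a) \<oplus> (-1) \<odot> (w \<cdot> \<iota> (M u) \<cdot> \<iota> a)"
    and dashv_eq: "\<lbrakk>u \<in> T; w \<in> T\<rbrakk> \<Longrightarrow> u \<stileturn> w = u \<cdot> \<iota> (M w)"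

end

theory Submission imports Defs begin

text \<open>
  Let \<open>D\<^sub>m\<close> be the derivation of the tensor algebra with \<open>D\<^sub>m a = m \<circ> a - m \<otimes> a\<close> on letters. The
  recursion for \<open>\<turnstile>\<close> says that \<open>u \<turnstile> w = L\<^sub>m w := m w + D\<^sub>m w\<close> with \<open>m = M u\<close>. Left symmetry of \<open>\<circ>\<close>
  gives \<open>M (L\<^sub>m w) = m \<circ> M w\<close> by induction on words; as \<open>u \<turnstile> w\<close> depends on \<open>u\<close> and \<open>u \<stileturn> w\<close> depends
  on \<open>w\<close> only through \<open>M\<close>, this yields the two bar identities, while the identity for \<open>\<stileturn>\<close> is the
  recursion for \<open>\<turnstile>\<close> at \<open>x \<cdot> M z\<close>. The identity for \<open>\<turnstile>\<close> amounts to
  \<open>[L\<^sub>m, L\<^sub>n] = L\<^sub>p\<close> for \<open>p = m \<circ> n - n \<circ> m\<close>. In it the multiplication parts cancel, leaving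
  \<open>[D\<^sub>m, D\<^sub>n] = D\<^sub>p\<close>, an equation between derivations, which need only be checked on letters,
  where it is left symmetry. All this is done for representatives in the free algebra, modulo the
  ideal generated by the linearity relations of the letters.
\<close>

section \<open>The monoid ring of words\<close>

text \<open>Multiplication of finitely supported functions is convolution over the addition of the
  index type. Taking concatenation as that addition turns
  \<open>'a list \<Rightarrow>\<^sub>0 'k\<close> into the free unital associative algebra, so ring
  simplification applies to representatives.\<close>

instantiation list :: (type) monoid_add
begin

definition zero_list_def: "0 = []"

definition plus_list_def: "xs + ys = xs @ ys"

instance
  by standard (simp_all add: zero_list_def plus_list_def)

end

interpretation free: vector_space "free_scale :: 'k::field \<Rightarrow> ('w \<Rightarrow>\<^sub>0 'k) \<Rightarrow> _"
  by (rule vector_space_free_scale)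

lemma linearI:
  assumes "vector_space s1" "vector_space s2"
    and "\<And>x y. f (x + y) = f x + f y" "\<And>c x. f (s1 c x) = s2 c (f x)"
  shows "Vector_Spaces.linear s1 s2 f"
  using assms by (auto simp: Vector_Spaces.linear_def module_hom_def module_hom_axioms_def
      vector_space_def module_def)

text \<open>Used to reduce membership claims about linear images to generators: words, or
  multilinearity relators.\<close>

lemma linear_span_mem:
  assumes "Vector_Spaces.linear s1 s2 f" and "module.subspace s2 S"
    and "\<And>b. b \<in> B \<Longrightarrow> f b \<in> S" and "x \<in> module.span s1 B"
  shows "f x \<in> S"
proof -
  interpret Vector_Spaces.linear s1 s2 f by fact
  have "f ` vs1.span B \<subseteq> S"
    unfolding span_image[symmetric] using assms(2,3) by (intro vs2.span_minimal) auto
  with assms(4) show ?thesis by blast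
qed

lemma poly_mapping_sum_keys:
  "p = (\<Sum>w\<in>Poly_Mapping.keys p. Poly_Mapping.single w (Poly_Mapping.lookup p w))"
  by (rule poly_mapping_eqI)
    (simp add: lookup_sum lookup_single when_def in_keys_iff sum.delta)

lemma single_eq_free_scale: "Poly_Mapping.single w c = free_scale c (free_word w)"
  by (simp add: free_scale_def free_word_def)

lemma span_free_word:
  "module.span free_scale (free_word ` W) = {p. Poly_Mapping.keys p \<subseteq> W}" (is "?S = ?K")
proof
  have "free.subspace ?K"
  proof (rule free.subspaceI)
    show "p + q \<in> ?K" if "p \<in> ?K" "q \<in> ?K" for p q
      using that keys_add[of p q] by auto
    show "free_scale c p \<in> ?K" if "p \<in> ?K" for c p
      using that by (auto simp: in_keys_iff)
  qed simp
  then show "?S \<subseteq> ?K"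
    by (rule free.span_minimal[rotated]) (auto simp: free_word_def)
  show "?K \<subseteq> ?S"
  proof
    fix p :: "'a list \<Rightarrow>\<^sub>0 'b" assume "p \<in> ?K"
    then have "(\<Sum>w\<in>Poly_Mapping.keys p. Poly_Mapping.single w (Poly_Mapping.lookup p w)) \<in> ?S"
      unfolding single_eq_free_scale
      by (intro free.span_sum free.span_scale free.span_base) blast
    then show "p \<in> ?S"
      by (simp flip: poly_mapping_sum_keys)
  qed
qed

lemma free_in_span: "p \<in> module.span free_scale (range free_word)"
  using span_free_word[of UNIV] by auto

lemma free_space_eq_span: "free_space = module.span free_scale (free_word ` {w. w \<noteq> []})"
  by (auto simp: span_free_word free_space_def)

lemma free_word_append: "free_word (xs @ ys) = free_word xs * free_word ys"
  by (simp add: free_word_def mult_single plus_list_def)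

lemma free_word_Nil: "free_word [] = 1"
  by (simp add: free_word_def flip: zero_list_def)

lemma free_scale_mult_left: "free_scale c p * q = free_scale c (p * q :: 'w::monoid_add \<Rightarrow>\<^sub>0 'k::field)"
  unfolding free_scale_def by (simp add: mult_map_scale_conv_mult mult.assoc)

text \<open>Scaling by \<open>c\<close> is multiplication by \<open>c\<close> times the neutral
  index, a central element: it commutes with every monomial because \<open>'k\<close> is
  commutative.\<close>

lemma free_scale_mult_right: "p * free_scale c q = free_scale c (p * q :: 'w::monoid_add \<Rightarrow>\<^sub>0 'k::field)"
proof -
  have "q * Poly_Mapping.single 0 c = Poly_Mapping.single 0 c * q" for q :: "'w \<Rightarrow>\<^sub>0 'k"
  proof -
    have "(\<Sum>w\<in>Poly_Mapping.keys q. Poly_Mapping.single w (Poly_Mapping.lookup q w)) * Poly_Mapping.single 0 c =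
        Poly_Mapping.single 0 c * (\<Sum>w\<in>Poly_Mapping.keys q. Poly_Mapping.single w (Poly_Mapping.lookup q w))"
      by (simp add: sum_distrib_left sum_distrib_right mult_single mult.commute)
    then show ?thesis
      by (simp flip: poly_mapping_sum_keys)
  qed
  then show ?thesis
    unfolding free_scale_def by (simp add: mult_map_scale_conv_mult flip: mult.assoc)
qed

lemma free_mult_eq_times: "free_mult p q = p * q"
proof -
  have "p * q = (\<Sum>w\<in>Poly_Mapping.keys p. Poly_Mapping.single w (Poly_Mapping.lookup p w)) *
      (\<Sum>w\<in>Poly_Mapping.keys q. Poly_Mapping.single w (Poly_Mapping.lookup q w))"
    by (simp flip: poly_mapping_sum_keys)
  then show ?thesis
    by (simp add: free_mult_def sum_product mult_single plus_list_def)
qed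

lemma linear_times_left: "Vector_Spaces.linear free_scale free_scale (\<lambda>q. p * q :: 'w::monoid_add \<Rightarrow>\<^sub>0 'k::field)"
  by (intro linearI vector_space_free_scale) (simp_all add: distrib_left free_scale_mult_right)

lemma linear_times_right: "Vector_Spaces.linear free_scale free_scale (\<lambda>q. q * p :: 'w::monoid_add \<Rightarrow>\<^sub>0 'k::field)"
  by (intro linearI vector_space_free_scale) (simp_all add: distrib_right free_scale_mult_left)

lemma subspace_free_space: "module.subspace free_scale free_space"
  by (simp add: free_space_eq_span)

lemmas free_space_add = free.subspace_add[OF subspace_free_space]
  and free_space_neg = free.subspace_neg[OF subspace_free_space]
  and free_space_diff = free.subspace_diff[OF subspace_free_space]
  and free_space_scale = free.subspace_scale[OF subspace_free_space]
  and free_space_zero = free.subspace_0[OF subspace_free_space]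

lemma free_word_in_free_space: "w \<noteq> [] \<Longrightarrow> free_word w \<in> free_space"
  by (simp add: free_space_def free_word_def)

lemma free_space_mult_left: "q \<in> free_space \<Longrightarrow> p * q \<in> free_space"
  using keys_mult[of p q] by (fastforce simp: free_space_def plus_list_def)

lemma free_space_mult_right: "p \<in> free_space \<Longrightarrow> p * q \<in> free_space"
  using keys_mult[of p q] by (fastforce simp: free_space_def plus_list_def)

text \<open>Linear extension from the basis; it supplies both \<open>free_M\<close> and the
  derivations.\<close>

definition free_extend :: "('k::field \<Rightarrow> 'v::ab_group_add \<Rightarrow> 'v) \<Rightarrow> ('w \<Rightarrow> 'v) \<Rightarrow> ('w \<Rightarrow>\<^sub>0 'k) \<Rightarrow> 'v" where
  "free_extend s f p = (\<Sum>w\<in>Poly_Mapping.keys p. s (Poly_Mapping.lookup p w) (f w))"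

text \<open>Enlarging the index set adds only zero coefficients. A common support for several
  arguments makes linearity of \<open>free_extend\<close> a termwise computation.\<close>

lemma free_extend_superset:
  assumes "vector_space s" "finite W" "Poly_Mapping.keys p \<subseteq> W"
  shows "free_extend s f p = (\<Sum>w\<in>W. s (Poly_Mapping.lookup p w) (f w))"
proof -
  interpret vector_space s by fact
  show ?thesis
    unfolding free_extend_def using assms(2,3)
    by (intro sum.mono_neutral_left) (auto simp: in_keys_iff)
qed

lemma linear_free_extend:
  fixes f :: "'w \<Rightarrow> 'v::ab_group_add" and s :: "'k::field \<Rightarrow> 'v \<Rightarrow> 'v"
  assumes "vector_space s"
  shows "Vector_Spaces.linear free_scale s (free_extend s f)"
proof (intro linearI vector_space_free_scale assms)
  interpret vector_space s by fact
  fix p q :: "'w \<Rightarrow>\<^sub>0 'k" and c :: 'k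
  let ?W = "Poly_Mapping.keys p \<union> Poly_Mapping.keys q"
  have "Poly_Mapping.keys (p + q) \<subseteq> ?W" "Poly_Mapping.keys (free_scale c p) \<subseteq> ?W"
    using keys_add[of p q] by (auto simp: in_keys_iff)
  then show "free_extend s f (p + q) = free_extend s f p + free_extend s f q"
    and "free_extend s f (free_scale c p) = s c (free_extend s f p)"
    by (simp_all add: free_extend_superset[OF assms, where W = ?W] lookup_add
        scale_left_distrib sum.distrib scale_sum_right)
qed

lemma free_extend_word:
  assumes "vector_space s"
  shows "free_extend s f (free_word w) = f w"
proof -
  interpret vector_space s by fact
  show ?thesis by (simp add: free_extend_def free_word_def)
qed

section \<open>Multilinearity relations\<close>

text \<open>A linear span is already a two-sided ideal here, since the relators carry arbitrary
  words on both sides; see \<open>relator_ideal_mult_left\<close> and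
  \<open>relator_ideal_mult_right\<close>.\<close>

definition relator_ideal :: "('k::field \<Rightarrow> 'a::ab_group_add \<Rightarrow> 'a) \<Rightarrow> ('a list \<Rightarrow>\<^sub>0 'k) set" where
  "relator_ideal s = module.span free_scale (multilinear_relators s)"

lemma subspace_relator_ideal: "module.subspace free_scale (relator_ideal s)"
  by (simp add: relator_ideal_def)

lemmas relator_ideal_zero = free.subspace_0[OF subspace_relator_ideal]
  and relator_ideal_add = free.subspace_add[OF subspace_relator_ideal]
  and relator_ideal_diff = free.subspace_diff[OF subspace_relator_ideal]
  and relator_ideal_scale = free.subspace_scale[OF subspace_relator_ideal]

text \<open>Pulling the surrounding words out isolates the two relations on single letters, so that
  later arguments can treat the context by ring multiplication.\<close>

lemma multilinear_relators_eq:
  "multilinear_relators s =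
     {free_word xs * (free_word [a + b] - free_word [a] - free_word [b]) * free_word ys | xs ys a b. True} \<union>
     {free_word xs * (free_word [s c a] - free_scale c (free_word [a])) * free_word ys | xs ys c a. True}"
  by (simp only: multilinear_relators_def free_word_append left_diff_distrib right_diff_distrib
      mult.assoc free_scale_mult_left free_scale_mult_right)

lemma multilinear_relators_cases:
  assumes "r \<in> multilinear_relators s"
  obtains (add) xs ys a b where
      "r = free_word xs * (free_word [a + b] - free_word [a] - free_word [b]) * free_word ys"
    | (scale) xs ys c a where
      "r = free_word xs * (free_word [s c a] - free_scale c (free_word [a])) * free_word ys"
  using assms unfolding multilinear_relators_eq by blast

lemma relator_word_add:
  "free_word xs * (free_word [a + b] - free_word [a] - free_word [b]) * free_word ys \<in> multilinear_relators s"
  unfolding multilinear_relators_eq by blast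

lemma relator_word_scale:
  "free_word xs * (free_word [s c a] - free_scale c (free_word [a])) * free_word ys \<in> multilinear_relators s"
  unfolding multilinear_relators_eq by blast

lemma relator_ideal_letter_add: "free_word [a + b] - free_word [a] - free_word [b] \<in> relator_ideal s"
  using relator_word_add[of "[]" a b "[]" s] by (simp add: free_word_Nil relator_ideal_def free.span_base)

lemma relator_ideal_letter_scale: "free_word [s c a] - free_scale c (free_word [a]) \<in> relator_ideal s"
  using relator_word_scale[of "[]" s c a "[]"] by (simp add: free_word_Nil relator_ideal_def free.span_base)

text \<open>A word on the left merges with the left context of a relator and gives a relator again;
  linearity in \<open>r\<close> and then in \<open>p\<close> does the rest.\<close>

lemma relator_ideal_mult_left:
  assumes "r \<in> relator_ideal s"
  shows "p * r \<in> relator_ideal s"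
proof -
  have *: "free_word w * r \<in> relator_ideal s" for w
  proof (rule linear_span_mem[OF linear_times_left subspace_relator_ideal _ assms[unfolded relator_ideal_def]])
    fix r assume "r \<in> multilinear_relators s"
    then have "free_word w * r \<in> multilinear_relators s"
      by (cases rule: multilinear_relators_cases)
        (simp_all only: mult.assoc[symmetric] free_word_append[symmetric] relator_word_add relator_word_scale)
    then show "free_word w * r \<in> relator_ideal s"
      by (simp add: relator_ideal_def free.span_base)
  qed
  show ?thesis
    by (rule linear_span_mem[OF linear_times_right subspace_relator_ideal _ free_in_span]) (auto simp: *)
qed

lemma relator_ideal_mult_right:
  assumes "r \<in> relator_ideal s"
  shows "r * p \<in> relator_ideal s"
proof -
  have *: "r * free_word w \<in> relator_ideal s" for w
  proof (rule linear_span_mem[OF linear_times_right subspace_relator_ideal _ assms[unfolded relator_ideal_def]])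
    fix r assume "r \<in> multilinear_relators s"
    then have "r * free_word w \<in> multilinear_relators s"
      by (cases rule: multilinear_relators_cases)
        (simp_all only: mult.assoc free_word_append[symmetric] relator_word_add[unfolded mult.assoc]
          relator_word_scale[unfolded mult.assoc])
    then show "r * free_word w \<in> relator_ideal s"
      by (simp add: relator_ideal_def free.span_base)
  qed
  show ?thesis
    by (rule linear_span_mem[OF linear_times_left subspace_relator_ideal _ free_in_span]) (auto simp: *)
qed

section \<open>Derivations of the monoid ring\<close>

lemmas linear_simps =
  module_hom.add[OF module_hom_iff_linear[THEN iffD2]]
  module_hom.scale[OF module_hom_iff_linear[THEN iffD2]]
  module_hom.diff[OF module_hom_iff_linear[THEN iffD2]]
  module_hom.zero[OF module_hom_iff_linear[THEN iffD2]]

lemma linear_eq_on_span: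
  assumes f: "Vector_Spaces.linear s1 s2 f" and g: "Vector_Spaces.linear s1 s2 g"
    and "\<And>b. b \<in> B \<Longrightarrow> f b = g b" "x \<in> module.span s1 B"
  shows "f x = g x"
proof -
  have "vector_space_pair s1 s2"
    using f by (simp add: Vector_Spaces.linear_def vector_space_pair_def)
  then show ?thesis
    using assms vector_space_pair.linear_eq_on by blast
qed

definition free_derivation :: "(('a list \<Rightarrow>\<^sub>0 'k::field) \<Rightarrow> ('a list \<Rightarrow>\<^sub>0 'k)) \<Rightarrow> bool" where
  "free_derivation E \<longleftrightarrow> Vector_Spaces.linear free_scale free_scale E \<and>
     (\<forall>p q. E (p * q) = E p * q + p * E q)"

lemma free_derivation_linear: "free_derivation E \<Longrightarrow> Vector_Spaces.linear free_scale free_scale E"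
  by (simp add: free_derivation_def)

lemma free_derivation_mult: "free_derivation E \<Longrightarrow> E (p * q) = E p * q + p * E q"
  by (simp add: free_derivation_def)

lemmas free_derivation_simps = free_derivation_mult linear_simps[OF free_derivation_linear]

lemma free_derivation_one: "free_derivation E \<Longrightarrow> E 1 = 0"
  using free_derivation_mult[of E 1 1] by simp

lemma free_derivation_add:
  assumes "free_derivation E" "free_derivation E'"
  shows "free_derivation (\<lambda>p. E p + E' p)"
  unfolding free_derivation_def
  by (auto intro!: linearI vector_space_free_scale
      simp: free_derivation_simps[OF assms(1)] free_derivation_simps[OF assms(2)]
        free.scale_right_distrib algebra_simps)

lemma free_derivation_scale:
  assumes "free_derivation E"
  shows "free_derivation (\<lambda>p. free_scale c (E p))"
  unfolding free_derivation_def
  by (auto intro!: linearI vector_space_free_scale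
      simp: free_derivation_simps[OF assms] free.scale_right_distrib mult.commute
        free_scale_mult_left free_scale_mult_right)

lemma free_derivation_diff:
  assumes "free_derivation E" "free_derivation E'"
  shows "free_derivation (\<lambda>p. E p - E' p)"
  using free_derivation_add[OF assms(1) free_derivation_scale[OF assms(2), of "- 1"]] by simp

text \<open>The mixed terms \<open>E p * E' q + E' p * E q\<close> are symmetric in \<open>E\<close>
  and \<open>E'\<close> and cancel.\<close>

lemma free_derivation_commutator:
  assumes "free_derivation E" "free_derivation E'"
  shows "free_derivation (\<lambda>p. E (E' p) - E' (E p))"
  unfolding free_derivation_def
  by (auto intro!: linearI vector_space_free_scale
      simp: free_derivation_simps[OF assms(1)] free_derivation_simps[OF assms(2)]
        free.scale_right_diff_distrib algebra_simps)

text \<open>By the Leibniz rule and absorption, induction on words reduces a congruence between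
  derivations to letters: it is applied to the derivation that is the difference of the two
  sides.\<close>

lemma free_derivation_in_ideal:
  assumes E: "free_derivation E" and letter: "\<And>a. E (free_word [a]) \<in> relator_ideal s"
  shows "E p \<in> relator_ideal s"
proof (rule linear_span_mem[OF free_derivation_linear[OF E] subspace_relator_ideal _ free_in_span])
  have "E (free_word w) \<in> relator_ideal s" for w
  proof (induction w)
    case Nil
    then show ?case
      by (simp add: free_word_Nil free_derivation_one[OF E] relator_ideal_zero)
  next
    case (Cons a w)
    then show ?case
      using free_word_append[of "[a]" w, where 'b = 'b]
      by (simp add: free_derivation_mult[OF E] letter relator_ideal_add
          relator_ideal_mult_left relator_ideal_mult_right)
  qed
  then show "E q \<in> relator_ideal s" if "q \<in> range free_word" for q
    using that by auto
qed

text \<open>In \<open>E p * q * p' + p * E q * p' + p * q * E p'\<close> the outer terms lie in the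
  ideal because \<open>q\<close> does, and the middle one because \<open>E q\<close> does. Hence
  only the relations on single letters remain to be checked.\<close>

lemma free_derivation_preserves_ideal:
  assumes E: "free_derivation E"
    and add: "\<And>a b. E (free_word [a + b] - free_word [a] - free_word [b]) \<in> relator_ideal s"
    and scale: "\<And>c a. E (free_word [s c a] - free_scale c (free_word [a])) \<in> relator_ideal s"
    and "r \<in> relator_ideal s"
  shows "E r \<in> relator_ideal s"
proof (rule linear_span_mem[OF free_derivation_linear[OF E] subspace_relator_ideal])
  show "r \<in> free.span (multilinear_relators s)"
    using assms(4) by (simp add: relator_ideal_def)
next
  have product: "E (p * q * p') \<in> relator_ideal s"
    if "q \<in> relator_ideal s" "E q \<in> relator_ideal s" for p q p'
    using that by (simp add: free_derivation_mult[OF E] distrib_right relator_ideal_add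
        relator_ideal_mult_left relator_ideal_mult_right)
  fix q assume "q \<in> multilinear_relators s"
  then show "E q \<in> relator_ideal s"
    by (cases rule: multilinear_relators_cases)
      (simp_all only: product relator_ideal_letter_add relator_ideal_letter_scale add scale)
qed

text \<open>The Leibniz rule unrolled from the left; the values \<open>d\<close> on letters can be
  prescribed freely.\<close>

primrec derivation_word :: "('a \<Rightarrow> ('a list \<Rightarrow>\<^sub>0 'k::field)) \<Rightarrow> 'a list \<Rightarrow> ('a list \<Rightarrow>\<^sub>0 'k)" where
  "derivation_word d [] = 0"
| "derivation_word d (a # w) = d a * free_word w + free_word [a] * derivation_word d w"

definition derivation_extend :: "('a \<Rightarrow> ('a list \<Rightarrow>\<^sub>0 'k::field)) \<Rightarrow> ('a list \<Rightarrow>\<^sub>0 'k) \<Rightarrow> ('a list \<Rightarrow>\<^sub>0 'k)" where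
  "derivation_extend d = free_extend free_scale (derivation_word d)"

lemma derivation_word_append:
  "derivation_word d (xs @ ys) = derivation_word d xs * free_word ys + free_word xs * derivation_word d ys"
proof (induction xs)
  case Nil
  then show ?case by (simp add: free_word_Nil)
next
  case (Cons a xs)
  have "free_word (a # xs) = free_word [a] * (free_word xs :: 'a list \<Rightarrow>\<^sub>0 'b)"
    using free_word_append[of "[a]" xs] by simp
  then show ?case
    using Cons by (simp add: free_word_append algebra_simps)
qed

lemma linear_derivation_extend: "Vector_Spaces.linear free_scale free_scale (derivation_extend d)"
  unfolding derivation_extend_def by (intro linear_free_extend vector_space_free_scale)

lemma derivation_extend_word: "derivation_extend d (free_word w) = derivation_word d w"
  by (simp add: derivation_extend_def free_extend_word vector_space_free_scale)

lemma free_derivation_extend: "free_derivation (derivation_extend d)"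
  unfolding free_derivation_def
proof (intro conjI linear_derivation_extend allI)
  note simps = linear_simps[OF linear_derivation_extend] free_scale_mult_left free_scale_mult_right
    free.scale_right_distrib
  let ?E = "derivation_extend d"
  \<comment> \<open>Both sides of the Leibniz rule are linear in each argument, so it is extended
    first in \<open>q\<close>, with a word on the left, and then in \<open>p\<close>.\<close>
  have word: "?E (free_word w * q) = ?E (free_word w) * q + free_word w * ?E q" for w q
    by (rule linear_eq_on_span[where f = "\<lambda>q. ?E (free_word w * q)", OF _ _ _ free_in_span])
      (auto intro!: linearI vector_space_free_scale
        simp: simps derivation_extend_word derivation_word_append algebra_simps simp flip: free_word_append)
  show "?E (p * q) = ?E p * q + p * ?E q" for p q
    by (rule linear_eq_on_span[where f = "\<lambda>p. ?E (p * q)", OF _ _ _ free_in_span])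
      (auto intro!: linearI vector_space_free_scale simp: simps word algebra_simps)
qed

lemma derivation_extend_letter: "derivation_extend d (free_word [a]) = d a"
  by (simp add: derivation_extend_word free_word_Nil)

lemma derivation_extend_in_free_space:
  assumes "\<And>a. d a \<in> free_space"
  shows "derivation_extend d p \<in> free_space"
proof (rule linear_span_mem[OF linear_derivation_extend subspace_free_space _ free_in_span])
  have "derivation_word d w \<in> free_space" for w
    using assms by (induction w) (auto simp: free_space_mult_left free_space_mult_right
      free_space_add free_space_zero)
  then show "derivation_extend d q \<in> free_space" if "q \<in> range free_word" for q
    using that by (auto simp: derivation_extend_word)
qed

section \<open>Representatives of the operations\<close>

context left_symmetric_algebra
begin

abbreviation letter :: "'a \<Rightarrow> ('a list \<Rightarrow>\<^sub>0 'k)" where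
  "letter a \<equiv> free_word [a]"

definition D :: "'a \<Rightarrow> ('a list \<Rightarrow>\<^sub>0 'k) \<Rightarrow> ('a list \<Rightarrow>\<^sub>0 'k)" where
  "D m = derivation_extend (\<lambda>a. letter (m \<circ>\<^sub>A a) - letter m * letter a)"

definition L :: "'a \<Rightarrow> ('a list \<Rightarrow>\<^sub>0 'k) \<Rightarrow> ('a list \<Rightarrow>\<^sub>0 'k)" where
  "L m p = letter m * p + D m p"

text \<open>At the empty word this is the unspecified \<open>hd []\<close>, which is why
  \<open>free_M_mult_letter\<close> and \<open>free_M_L\<close> are restricted to
  \<open>free_space\<close>.\<close>

definition fold_word :: "'a list \<Rightarrow> 'a" where
  "fold_word w = foldl (\<circ>\<^sub>A) (hd w) (tl w)"

definition free_M :: "('a list \<Rightarrow>\<^sub>0 'k) \<Rightarrow> 'a" where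
  "free_M = free_extend scale fold_word"

lemmas circ_simps = linear_simps[OF linear_right] linear_simps[OF linear_left]

section \<open>The derivations \<open>D m\<close> modulo the ideal\<close>

lemma free_derivation_D: "free_derivation (D m)"
  by (simp add: D_def free_derivation_extend)

lemma D_letter: "D m (letter a) = letter (m \<circ>\<^sub>A a) - letter m * letter a"
  by (simp add: D_def derivation_extend_letter)

lemmas D_simps = free_derivation_simps[OF free_derivation_D] D_letter

text \<open>Since \<circ> is linear on the right, \<open>D m\<close> sends a letter relation to the
  same relation between the letters \<open>m \<circ>\<^sub>A a\<close>, minus
  \<open>letter m\<close> times the original one.\<close>

lemma D_preserves_ideal: "r \<in> relator_ideal scale \<Longrightarrow> D m r \<in> relator_ideal scale"
proof (erule free_derivation_preserves_ideal[OF free_derivation_D, rotated 2])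
  fix a b
  have "D m (letter (a + b) - letter a - letter b) =
      (letter (m \<circ>\<^sub>A a + m \<circ>\<^sub>A b) - letter (m \<circ>\<^sub>A a) - letter (m \<circ>\<^sub>A b))
      - letter m * (letter (a + b) - letter a - letter b)"
    by (simp add: D_simps circ_simps algebra_simps)
  then show "D m (letter (a + b) - letter a - letter b) \<in> relator_ideal scale"
    by (simp only: relator_ideal_diff relator_ideal_letter_add relator_ideal_mult_left)
next
  fix c a
  have "D m (letter (scale c a) - free_scale c (letter a)) =
      (letter (scale c (m \<circ>\<^sub>A a)) - free_scale c (letter (m \<circ>\<^sub>A a)))
      - letter m * (letter (scale c a) - free_scale c (letter a))"
    by (simp add: D_simps circ_simps algebra_simps free_scale_mult_right free.scale_right_diff_distrib)
  then show "D m (letter (scale c a) - free_scale c (letter a)) \<in> relator_ideal scale"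
    by (simp only: relator_ideal_diff relator_ideal_letter_scale relator_ideal_mult_left)
qed

text \<open>Only a congruence: \<open>letter (m + n)\<close> is a basis word of its own in the free
  algebra. Together with \<open>D_scale\<close> it gives linearity of \<turnstile> in its first
  argument.\<close>

lemma D_add: "D (m + n) p - D m p - D n p \<in> relator_ideal scale"
proof (rule free_derivation_in_ideal[where E = "\<lambda>p. D (m + n) p - D m p - D n p"])
  show "free_derivation (\<lambda>p. D (m + n) p - D m p - D n p)"
    by (intro free_derivation_diff free_derivation_D)
  fix a
  have "D (m + n) (letter a) - D m (letter a) - D n (letter a) =
      (letter (m \<circ>\<^sub>A a + n \<circ>\<^sub>A a) - letter (m \<circ>\<^sub>A a) - letter (n \<circ>\<^sub>A a))
      - (letter (m + n) - letter m - letter n) * letter a"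
    by (simp add: D_simps circ_simps algebra_simps)
  then show "D (m + n) (letter a) - D m (letter a) - D n (letter a) \<in> relator_ideal scale"
    by (simp only: relator_ideal_diff relator_ideal_letter_add relator_ideal_mult_right)
qed

lemma D_scale: "D (scale c m) p - free_scale c (D m p) \<in> relator_ideal scale"
proof (rule free_derivation_in_ideal[where E = "\<lambda>p. D (scale c m) p - free_scale c (D m p)"])
  show "free_derivation (\<lambda>p. D (scale c m) p - free_scale c (D m p))"
    by (intro free_derivation_diff free_derivation_scale free_derivation_D)
  fix a
  have "D (scale c m) (letter a) - free_scale c (D m (letter a)) =
      (letter (scale c (m \<circ>\<^sub>A a)) - free_scale c (letter (m \<circ>\<^sub>A a)))
      - (letter (scale c m) - free_scale c (letter m)) * letter a"
    by (simp add: D_simps circ_simps algebra_simps free_scale_mult_left free.scale_right_diff_distrib)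
  then show "D (scale c m) (letter a) - free_scale c (D m (letter a)) \<in> relator_ideal scale"
    by (simp only: relator_ideal_diff relator_ideal_letter_scale relator_ideal_mult_right)
qed

text \<open>Both pairs have the same sum, so two additivity relators share the letter of that sum.
  This turns left symmetry, written without signs, into a congruence.\<close>

lemma letter_relation:
  assumes "a + d = b + c"
  shows "letter a - letter b - letter c + letter d \<in> relator_ideal scale"
proof -
  have "letter a - letter b - letter c + letter d =
      (letter (b + c) - letter b - letter c) - (letter (a + d) - letter a - letter d)"
    by (simp add: assms)
  then show ?thesis
    by (simp only: relator_ideal_diff relator_ideal_letter_add)
qed

lemma D_commutator:
  "D m (D n p) - D n (D m p) - D (m \<circ>\<^sub>A n) p + D (n \<circ>\<^sub>A m) p \<in> relator_ideal scale"
proof (rule free_derivation_in_ideal[where E = "\<lambda>p. D m (D n p) - D n (D m p) - D (m \<circ>\<^sub>A n) p + D (n \<circ>\<^sub>A m) p"])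
  show "free_derivation (\<lambda>p. D m (D n p) - D n (D m p) - D (m \<circ>\<^sub>A n) p + D (n \<circ>\<^sub>A m) p)"
    by (intro free_derivation_add free_derivation_diff free_derivation_commutator free_derivation_D)
  fix a
  \<comment> \<open>The words of length three are symmetric in \<open>m\<close> and
    \<open>n\<close>. Among those of length two,
    \<open>letter (m \<circ>\<^sub>A n) * letter a\<close> and its mirror image cancel against the
    last two derivations, and the rest is symmetric.\<close>
  have "D m (D n (letter a)) - D n (D m (letter a)) - D (m \<circ>\<^sub>A n) (letter a) + D (n \<circ>\<^sub>A m) (letter a) =
      letter (m \<circ>\<^sub>A (n \<circ>\<^sub>A a)) - letter (n \<circ>\<^sub>A (m \<circ>\<^sub>A a))
      - letter ((m \<circ>\<^sub>A n) \<circ>\<^sub>A a) + letter ((n \<circ>\<^sub>A m) \<circ>\<^sub>A a)"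
    by (simp add: D_simps algebra_simps)
  moreover have "m \<circ>\<^sub>A (n \<circ>\<^sub>A a) + (n \<circ>\<^sub>A m) \<circ>\<^sub>A a = n \<circ>\<^sub>A (m \<circ>\<^sub>A a) + (m \<circ>\<^sub>A n) \<circ>\<^sub>A a"
    using left_symmetric[of m n a] by (simp add: algebra_simps)
  ultimately show "D m (D n (letter a)) - D n (D m (letter a)) - D (m \<circ>\<^sub>A n) (letter a)
      + D (n \<circ>\<^sub>A m) (letter a) \<in> relator_ideal scale"
    by (simp only: letter_relation)
qed

section \<open>The operators \<open>L m\<close>, which represent the left action of
  \<turnstile>\<close>

lemma linear_L: "Vector_Spaces.linear free_scale free_scale (L m)"
  by (intro linearI vector_space_free_scale)
    (simp_all add: L_def D_simps distrib_left free_scale_mult_right free.scale_right_distrib)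

lemma L_preserves_ideal: "r \<in> relator_ideal scale \<Longrightarrow> L m r \<in> relator_ideal scale"
  by (simp add: L_def relator_ideal_add relator_ideal_mult_left D_preserves_ideal)

lemma L_add: "L (m + n) p - L m p - L n p \<in> relator_ideal scale"
proof -
  have "L (m + n) p - L m p - L n p =
      (letter (m + n) - letter m - letter n) * p + (D (m + n) p - D m p - D n p)"
    by (simp add: L_def algebra_simps)
  then show ?thesis
    by (simp only: relator_ideal_add relator_ideal_mult_right relator_ideal_letter_add D_add)
qed

lemma L_scale: "L (scale c m) p - free_scale c (L m p) \<in> relator_ideal scale"
proof -
  have "L (scale c m) p - free_scale c (L m p) =
      (letter (scale c m) - free_scale c (letter m)) * p + (D (scale c m) p - free_scale c (D m p))"
    by (simp add: L_def algebra_simps free_scale_mult_left free.scale_right_distrib)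
  then show ?thesis
    by (simp only: relator_ideal_add relator_ideal_mult_right relator_ideal_letter_scale D_scale)
qed

lemma L_commutator:
  "L m (L n p) - L n (L m p) - L (m \<circ>\<^sub>A n) p + L (n \<circ>\<^sub>A m) p \<in> relator_ideal scale"
proof -
  \<comment> \<open>An exact equality: in \<open>L m (L n p)\<close> the product
    \<open>letter m * letter n * p\<close> is cancelled by the value of \<open>D m\<close> at
    \<open>letter n\<close>, leaving \<open>letter (m \<circ>\<^sub>A n) * p\<close>, which the term
    \<open>L (m \<circ>\<^sub>A n) p\<close> removes.\<close>
  have "L m (L n p) - L n (L m p) - L (m \<circ>\<^sub>A n) p + L (n \<circ>\<^sub>A m) p =
      D m (D n p) - D n (D m p) - D (m \<circ>\<^sub>A n) p + D (n \<circ>\<^sub>A m) p"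
    by (simp add: L_def D_simps algebra_simps)
  then show ?thesis
    by (simp only: D_commutator)
qed

text \<open>With \<open>L_mult_letter\<close>, these are the two clauses of the recursion for
  \<turnstile>, valid for representatives before passing to the quotient.\<close>

lemma L_letter: "L m (letter a) = letter (m \<circ>\<^sub>A a)"
  by (simp add: L_def D_letter)

lemma L_mult_letter:
  "L m (p * letter a) = L m p * letter a + p * letter (m \<circ>\<^sub>A a) - p * letter m * letter a"
  by (simp add: L_def D_simps algebra_simps)

text \<open>Every term carries a letter, even for \<open>p = 1\<close>: multiplication by
  \<open>letter m\<close> adds one, and \<open>D m\<close> kills the empty word.\<close>

lemma L_in_free_space: "L m p \<in> free_space"
proof -
  have "D m p \<in> free_space"
    unfolding D_def
    by (intro derivation_extend_in_free_space free_space_diff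
        free_space_mult_left free_word_in_free_space) simp_all
  then show ?thesis
    by (simp add: L_def free_space_add free_space_mult_right
        free_word_in_free_space)
qed

section \<open>The map \<open>M\<close> on representatives\<close>

lemma fold_word_snoc: "w \<noteq> [] \<Longrightarrow> fold_word (w @ [a]) = fold_word w \<circ>\<^sub>A a"
  by (simp add: fold_word_def)

text \<open>The last letter enters the outermost product, hence induction from the right: linearity
  of \<circ> on the right handles the varied letter in last place, linearity on the left each letter
  after it.\<close>

lemma fold_word_add: "fold_word (xs @ [a + b] @ ys) = fold_word (xs @ [a] @ ys) + fold_word (xs @ [b] @ ys)"
proof (induction ys rule: rev_induct)
  case Nil
  then show ?case
    by (cases "xs = []") (simp_all add: fold_word_snoc circ_simps, simp add: fold_word_def)
next
  case (snoc y ys)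
  then show ?case
    using fold_word_snoc[of "xs @ [_] @ ys" y] by (simp add: circ_simps)
qed

lemma fold_word_scale: "fold_word (xs @ [scale c a] @ ys) = scale c (fold_word (xs @ [a] @ ys))"
proof (induction ys rule: rev_induct)
  case Nil
  then show ?case
    by (cases "xs = []") (simp_all add: fold_word_snoc circ_simps, simp add: fold_word_def)
next
  case (snoc y ys)
  then show ?case
    using fold_word_snoc[of "xs @ [_] @ ys" y] by (simp add: circ_simps)
qed

lemma linear_free_M: "Vector_Spaces.linear free_scale scale free_M"
  unfolding free_M_def by (intro linear_free_extend vector_space_axioms)

lemma free_M_word: "free_M (free_word w) = fold_word w"
  by (simp add: free_M_def free_extend_word vector_space_axioms)

lemma free_M_letter: "free_M (letter a) = a"
  by (simp add: free_M_word fold_word_def)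

lemma free_M_ideal:
  assumes "r \<in> relator_ideal scale"
  shows "free_M r = 0"
proof -
  have "free_M r \<in> {0}"
  proof (rule linear_span_mem[OF linear_free_M _ _ assms[unfolded relator_ideal_def]])
    show "free_M q \<in> {0}" if "q \<in> multilinear_relators scale" for q
      using that fold_word_add fold_word_scale
      by (auto simp: multilinear_relators_def linear_simps[OF linear_free_M] free_M_word)
  qed simp
  then show ?thesis by simp
qed

lemma free_M_mult_letter:
  assumes "p \<in> free_space"
  shows "free_M (p * letter a) = free_M p \<circ>\<^sub>A a"
  by (rule linear_eq_on_span[where f = "\<lambda>p. free_M (p * letter a)", OF _ _ _ assms[unfolded free_space_eq_span]])
    (auto intro!: linearI vector_space_free_scale vector_space_axioms
      simp: linear_simps[OF linear_free_M] circ_simps distrib_right free_scale_mult_left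
        free_M_word fold_word_snoc simp flip: free_word_append)

lemma free_M_L:
  assumes "p \<in> free_space"
  shows "free_M (L m p) = m \<circ>\<^sub>A free_M p"
proof (rule linear_eq_on_span[where f = "\<lambda>p. free_M (L m p)", OF _ _ _ assms[unfolded free_space_eq_span]])
  have "free_M (L m (free_word w)) = m \<circ>\<^sub>A fold_word w" if "w \<noteq> []" for w
    using that
  proof (induction w rule: rev_induct)
    case (snoc a w)
    show ?case
    proof (cases "w = []")
      case True
      then show ?thesis
        by (simp add: L_letter free_M_word fold_word_def)
    next
      case False
      then have w: "free_word w \<in> (free_space :: ('a list \<Rightarrow>\<^sub>0 'k) set)"
        by (rule free_word_in_free_space)
      \<comment> \<open>The three terms of \<open>L_mult_letter\<close> under \<open>free_M\<close>,
        with the induction hypothesis in the first; left symmetry for \<open>m\<close>,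
        \<open>fold_word w\<close>, \<open>a\<close> collapses them.\<close>
      have "free_M (L m (free_word (w @ [a]))) =
          (m \<circ>\<^sub>A fold_word w) \<circ>\<^sub>A a + fold_word w \<circ>\<^sub>A (m \<circ>\<^sub>A a) - (fold_word w \<circ>\<^sub>A m) \<circ>\<^sub>A a"
        using snoc False w
        by (simp add: free_word_append L_mult_letter linear_simps[OF linear_free_M]
            free_M_mult_letter L_in_free_space free_space_mult_right free_M_word)
      also have "\<dots> = m \<circ>\<^sub>A (fold_word w \<circ>\<^sub>A a)"
        using left_symmetric[of m "fold_word w" a] by (simp add: algebra_simps)
      finally show ?thesis
        using False by (simp add: fold_word_snoc)
    qed
  qed simp
  then show "free_M (L m q) = m \<circ>\<^sub>A free_M q" if "q \<in> free_word ` {w. w \<noteq> []}" for q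
    using that by (auto simp: free_M_word)
qed (auto intro!: linearI vector_space_free_scale vector_space_axioms
  simp: linear_simps[OF linear_free_M] linear_simps[OF linear_L] circ_simps)

end

section \<open>The tensor algebra as a quotient\<close>

lemma tensor_class_mem_iff:
  "q \<in> tensor_class s p \<longleftrightarrow> p \<in> free_space \<and> q \<in> free_space \<and> p - q \<in> relator_ideal s"
  by (simp add: tensor_class_def tensor_rel_def relator_ideal_def)

lemma relator_ideal_diff_commute: "p - q \<in> relator_ideal s \<longleftrightarrow> q - p \<in> relator_ideal s"
  using free.subspace_neg[OF subspace_relator_ideal, of "p - q" s]
    free.subspace_neg[OF subspace_relator_ideal, of "q - p" s] by auto

lemma tensor_class_eqI:
  assumes "p \<in> free_space" "q \<in> free_space" "p - q \<in> relator_ideal s"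
  shows "tensor_class s p = tensor_class s q"
proof -
  have "q - r \<in> relator_ideal s \<longleftrightarrow> p - r \<in> relator_ideal s" for r
    using relator_ideal_add[OF assms(3), of "q - r"] relator_ideal_diff[OF _ assms(3), of "p - r"]
    by auto
  then show ?thesis
    using assms(1,2) by (auto simp: tensor_class_mem_iff)
qed

lemma tensor_class_self: "p \<in> free_space \<Longrightarrow> p \<in> tensor_class s p"
  by (simp add: tensor_class_mem_iff relator_ideal_zero)

lemma tensor_space_eq: "tensor_space s = tensor_class s ` free_space"
  by (auto simp: tensor_space_def quotient_def tensor_class_def)

lemma tensor_class_in_tensor_space: "p \<in> free_space \<Longrightarrow> tensor_class s p \<in> tensor_space s"
  by (simp add: tensor_space_eq)

text \<open>The operations on classes are unions over representatives; such a union collapses once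
  the value is constant on the class.\<close>

lemma UNION_tensor_class:
  assumes "p \<in> free_space"
    and "\<And>p'. p' \<in> free_space \<Longrightarrow> p - p' \<in> relator_ideal s \<Longrightarrow> f p' = X"
  shows "(\<Union>p'\<in>tensor_class s p. f p') = X"
proof (rule SUP_eq_const)
  show "tensor_class s p \<noteq> {}"
    using tensor_class_self[OF assms(1)] by blast
qed (simp add: assms(2) tensor_class_mem_iff)

lemma tensor_add_class:
  assumes "p \<in> free_space" "q \<in> free_space"
  shows "tensor_add s (tensor_class s p) (tensor_class s q) = tensor_class s (p + q)"
  unfolding tensor_add_def
proof (intro UNION_tensor_class assms tensor_class_eqI free_space_add)
  fix p' q' assume "p - p' \<in> relator_ideal s" "q - q' \<in> relator_ideal s"
  then have "p' - p + (q' - q) \<in> relator_ideal s"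
    by (intro relator_ideal_add) (simp_all add: relator_ideal_diff_commute)
  then show "p' + q' - (p + q) \<in> relator_ideal s"
    by (simp add: algebra_simps)
qed

lemma tensor_scale_class:
  assumes "p \<in> free_space"
  shows "tensor_scale s c (tensor_class s p) = tensor_class s (free_scale c p)"
  unfolding tensor_scale_def
proof (intro UNION_tensor_class assms tensor_class_eqI free_space_scale)
  fix p' assume "p - p' \<in> relator_ideal s"
  then show "free_scale c p' - free_scale c p \<in> relator_ideal s"
    by (simp add: relator_ideal_diff_commute relator_ideal_scale flip: free.scale_right_diff_distrib)
qed

lemma tensor_mult_class:
  assumes "p \<in> free_space" "q \<in> free_space"
  shows "tensor_mult s (tensor_class s p) (tensor_class s q) = tensor_class s (p * q)"
  unfolding tensor_mult_def free_mult_eq_times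
proof (intro UNION_tensor_class assms tensor_class_eqI free_space_mult_left)
  fix p' q' assume "p - p' \<in> relator_ideal s" "q - q' \<in> relator_ideal s"
  then have "(p' - p) * q' + p * (q' - q) \<in> relator_ideal s"
    by (intro relator_ideal_add relator_ideal_mult_left relator_ideal_mult_right)
      (simp_all add: relator_ideal_diff_commute)
  then show "p' * q' - p * q \<in> relator_ideal s"
    by (simp add: algebra_simps)
qed

lemmas tensor_class_simps = tensor_add_class tensor_scale_class tensor_mult_class
  free_space_add free_space_neg free_space_diff free_space_scale free_space_mult_left free_word_in_free_space

lemma vector_space_on_tensor_space:
  "vector_space_on (tensor_space s) (tensor_add s) (tensor_zero s) (tensor_scale s)"
proof
  fix x assume "x \<in> tensor_space s"
  then obtain p where "p \<in> free_space" "x = tensor_class s p"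
    by (auto simp: tensor_space_eq)
  then have "tensor_class s (- p) \<in> tensor_space s"
    and "tensor_add s x (tensor_class s (- p)) = tensor_zero s"
    by (simp_all add: tensor_class_simps tensor_class_in_tensor_space tensor_zero_def)
  then show "\<exists>y\<in>tensor_space s. tensor_add s x y = tensor_zero s"
    by blast
qed (auto simp: tensor_space_eq tensor_zero_def tensor_class_simps free_space_zero
    free.scale_left_distrib free.scale_right_distrib algebra_simps
    tensor_add_class[where q = 0, simplified free_space_zero])

lemma free_space_induct [consumes 1, case_names word add scale]:
  assumes "p \<in> free_space"
    and word: "\<And>w. w \<noteq> [] \<Longrightarrow> P (free_word w)"
    and add: "\<And>p q. p \<in> free_space \<Longrightarrow> q \<in> free_space \<Longrightarrow> P p \<Longrightarrow> P q \<Longrightarrow> P (p + q)"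
    and scale: "\<And>c p. p \<in> free_space \<Longrightarrow> P p \<Longrightarrow> P (free_scale c p)"
  shows "P p"
proof -
  \<comment> \<open>Zero has no case of its own; it is the zero multiple of an arbitrary one-letter
    word.\<close>
  have "P (free_scale 0 (free_word [undefined]))"
    by (intro scale word free_word_in_free_space) simp_all
  then have "free.subspace {p. p \<in> free_space \<and> P p}"
    by (auto simp: free.subspace_def free_space_zero free_space_add free_space_scale add scale)
  then have "p \<in> free_space \<and> P p"
    by (rule free.span_induct[OF assms(1)[unfolded free_space_eq_span]])
      (auto simp: word free_word_in_free_space)
  then show ?thesis ..
qed

section \<open>The operations on classes and the dialgebra identities\<close>

context left_symmetric_algebra
begin

abbreviation cl :: "('a list \<Rightarrow>\<^sub>0 'k) \<Rightarrow> ('a, 'k) tensor" where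
  "cl \<equiv> tensor_class scale"

lemma free_M_cong: "p - q \<in> relator_ideal scale \<Longrightarrow> free_M p = free_M q"
  using free_M_ideal[of "p - q"] by (simp add: linear_simps[OF linear_free_M])

lemma L_cong: "p - q \<in> relator_ideal scale \<Longrightarrow> cl (L m p) = cl (L m q)"
  by (intro tensor_class_eqI L_in_free_space)
    (simp add: L_preserves_ideal flip: linear_simps[OF linear_L])

lemma cl_L_add: "cl (L (m + n) p) = cl (L m p + L n p)"
  using L_add[of m n p] by (intro tensor_class_eqI) (simp_all add: L_in_free_space free_space_add diff_diff_eq)

lemma cl_L_scale: "cl (L (scale c m) p) = cl (free_scale c (L m p))"
  by (intro tensor_class_eqI L_scale L_in_free_space free_space_scale)

lemma cl_letter_add: "cl (p * letter (a + b)) = cl (p * letter a + p * letter b)"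
proof (intro tensor_class_eqI)
  have "p * (letter (a + b) - letter a - letter b) \<in> relator_ideal scale"
    by (intro relator_ideal_mult_left relator_ideal_letter_add)
  then show "p * letter (a + b) - (p * letter a + p * letter b) \<in> relator_ideal scale"
    by (simp add: algebra_simps)
qed (simp_all add: tensor_class_simps)

lemma cl_letter_scale: "cl (p * letter (scale c a)) = cl (free_scale c (p * letter a))"
proof (intro tensor_class_eqI)
  have "p * (letter (scale c a) - free_scale c (letter a)) \<in> relator_ideal scale"
    by (intro relator_ideal_mult_left relator_ideal_letter_scale)
  then show "p * letter (scale c a) - free_scale c (p * letter a) \<in> relator_ideal scale"
    by (simp add: algebra_simps free_scale_mult_right)
qed (simp_all add: tensor_class_simps)

text \<open>Uniqueness: the recursive description determines the operations on words, and linearity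
  does the rest, so any admissible operations are computed by \<open>free_M\<close> and
  \<open>L\<close>.\<close>

lemma tensor_operations_representatives:
  assumes "tensor_operations scale (\<circ>\<^sub>A) M vdash dashv"
    and p: "p \<in> free_space" and q: "q \<in> free_space"
  shows "M (cl p) = free_M p"
    and "vdash (cl p) (cl q) = cl (L (free_M p) q)"
    and "dashv (cl p) (cl q) = cl (p * letter (free_M q))"
proof -
  interpret tensor_operations scale "(\<circ>\<^sub>A)" M vdash dashv "tensor_space scale" "tensor_add scale"
    "tensor_scale scale" "tensor_mult scale" "\<lambda>a. tensor_word scale [a]"
    by (rule assms(1)) simp_all
  have M: "M (cl p) = free_M p" if "p \<in> free_space" for p
    using that
  proof (induction p rule: free_space_induct)
    case (word w)
    then show ?case
      using M_word[of "hd w" "tl w"] by (simp add: tensor_word_def free_M_word fold_word_def)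
  next
    case (add p q)
    then show ?case
      using M_add[of "cl p" "cl q"]
      by (simp add: tensor_add_class tensor_class_in_tensor_space linear_simps[OF linear_free_M])
  next
    case (scale c p)
    then show ?case
      using M_smult[of "cl p" c]
      by (simp add: tensor_scale_class tensor_class_in_tensor_space linear_simps[OF linear_free_M])
  qed
  note T = tensor_class_in_tensor_space[of _ scale]
  show "M (cl p) = free_M p"
    by (rule M[OF p])
  show "dashv (cl p) (cl q) = cl (p * letter (free_M q))"
    using p q by (simp add: dashv_eq T M tensor_word_def tensor_class_simps)
  let ?m = "free_M p"
  show "vdash (cl p) (cl q) = cl (L ?m q)"
    using q
  proof (induction q rule: free_space_induct)
    case (word w)
    then show ?case
    proof (induction w rule: rev_induct)
      case (snoc a w)
      show ?case
      \<comment> \<open>The product clause requires a left factor in the tensor space, which has no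
        identity, so one-letter words go through the letter clause.\<close>
      proof (cases "w = []")
        case True
        then show ?thesis
          using p vdash_letter[of "cl p" a] by (simp add: T M tensor_word_def L_letter)
      next
        case False
        then have w: "free_word w \<in> (free_space :: ('a list \<Rightarrow>\<^sub>0 'k) set)"
          by (rule free_word_in_free_space)
        have "cl (free_word (w @ [a])) = tensor_mult scale (cl (free_word w)) (cl (letter a))"
          by (simp add: tensor_class_simps w free_word_append)
        then show ?thesis
          using vdash_mult_letter[of "cl p" "cl (free_word w)" a] snoc.IH[OF False] p w
          by (simp add: T M tensor_word_def tensor_class_simps free_word_append L_mult_letter
              L_in_free_space algebra_simps)
      qed
    qed simp
  next
    case (add q r)
    then show ?case
      using vdash_bilinear p unfolding bilinear_on_def
      by (simp add: T L_in_free_space linear_simps[OF linear_L] flip: tensor_add_class)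
  next
    case (scale c q)
    then show ?case
      using vdash_bilinear p unfolding bilinear_on_def
      by (simp add: T L_in_free_space linear_simps[OF linear_L] flip: tensor_scale_class)
  qed
qed

text \<open>Stated for any \<open>f\<close> because it serves both the operation constructed for
  existence and an arbitrary admissible one.\<close>

lemma bilinear_on_vdash_representatives:
  assumes "\<And>p q. p \<in> free_space \<Longrightarrow> q \<in> free_space \<Longrightarrow> f (cl p) (cl q) = cl (L (free_M p) q)"
  shows "bilinear_on (tensor_space scale) (tensor_add scale) (tensor_scale scale) f"
  by (auto simp: bilinear_on_def tensor_space_eq tensor_class_simps assms L_in_free_space
      cl_L_add cl_L_scale linear_simps[OF linear_free_M] linear_simps[OF linear_L])

lemma bilinear_on_dashv_representatives:
  assumes "\<And>p q. p \<in> free_space \<Longrightarrow> q \<in> free_space \<Longrightarrow> f (cl p) (cl q) = cl (p * letter (free_M q))"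
  shows "bilinear_on (tensor_space scale) (tensor_add scale) (tensor_scale scale) f"
  by (auto simp: bilinear_on_def tensor_space_eq tensor_class_simps assms
      cl_letter_add cl_letter_scale distrib_right free_scale_mult_left linear_simps[OF linear_free_M])

text \<open>Shows that the recursion is consistent, so that the statement about all admissible
  operations is not vacuous.\<close>

lemma tensor_operations_exist: "\<exists>M vdash dashv. tensor_operations scale (\<circ>\<^sub>A) M vdash dashv"
proof -
  \<comment> \<open>Representatives are chosen arbitrarily; \<open>free_M_cong\<close> and
    \<open>L_cong\<close> make the results independent of the choice.\<close>
  define rep where "rep X = (SOME p. p \<in> X)" for X :: "('a, 'k) tensor"
  have rep: "rep (cl p) \<in> free_space" "rep (cl p) - p \<in> relator_ideal scale" if "p \<in> free_space" for p
  proof -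
    have "rep (cl p) \<in> cl p"
      unfolding rep_def by (rule someI) (rule tensor_class_self[OF that])
    then show "rep (cl p) \<in> free_space" "rep (cl p) - p \<in> relator_ideal scale"
      by (simp_all add: tensor_class_mem_iff relator_ideal_diff_commute)
  qed
  define M where "M X = free_M (rep X)" for X
  define vdash where "vdash X Y = cl (L (M X) (rep Y))" for X Y
  define dashv where "dashv X Y = tensor_mult scale X (tensor_word scale [M Y])" for X Y
  have M: "M (cl p) = free_M p" if "p \<in> free_space" for p
    using rep[OF that] by (simp add: M_def free_M_cong)
  have vdash: "vdash (cl p) (cl q) = cl (L (free_M p) q)" if "p \<in> free_space" "q \<in> free_space" for p q
    using that by (simp add: vdash_def M L_cong[OF rep(2)])
  have "tensor_operations scale (\<circ>\<^sub>A) M vdash dashv"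
  proof
    show "bilinear_on (tensor_space scale) (tensor_add scale) (tensor_scale scale) vdash"
      by (rule bilinear_on_vdash_representatives) (rule vdash)
  qed (auto simp: tensor_space_eq tensor_word_def tensor_class_simps M vdash dashv_def
      linear_simps[OF linear_free_M] free_M_word fold_word_def L_letter L_mult_letter L_in_free_space
      algebra_simps)
  then show ?thesis by blast
qed

lemma left_symmetric_dialgebra_tensor_operations:
  assumes "tensor_operations scale (\<circ>\<^sub>A) M vdash dashv"
  shows "left_symmetric_dialgebra (tensor_space scale) (tensor_add scale) (tensor_zero scale)
    (tensor_scale scale) vdash dashv"
proof -
  note rep = tensor_operations_representatives(2,3)[OF assms]
  note simps = rep tensor_class_simps L_in_free_space free_M_L free_M_mult_letter free_M_letter
  interpret vector_space_on "tensor_space scale" "tensor_add scale" "tensor_zero scale" "tensor_scale scale"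
    by (rule vector_space_on_tensor_space)
  show ?thesis
  proof
    show "bilinear_on (tensor_space scale) (tensor_add scale) (tensor_scale scale) vdash"
      by (rule bilinear_on_vdash_representatives) (rule rep)
    show "bilinear_on (tensor_space scale) (tensor_add scale) (tensor_scale scale) dashv"
      by (rule bilinear_on_dashv_representatives) (rule rep)
  next
    fix x y z
    assume "x \<in> tensor_space scale" "y \<in> tensor_space scale" "z \<in> tensor_space scale"
    then obtain p q r where p: "p \<in> free_space" "x = cl p" and q: "q \<in> free_space" "y = cl q"
      and r: "r \<in> free_space" "z = cl r"
      by (auto simp: tensor_space_eq)
    \<comment> \<open>In the first identity both left factors are mapped by \<open>M\<close> to
      \<open>free_M p \<circ>\<^sub>A free_M q\<close>, in the second both right factors to
      \<open>free_M q \<circ>\<^sub>A free_M r\<close>; one side uses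
      \<open>free_M_mult_letter\<close>, the other \<open>free_M_L\<close>.\<close>
    show "vdash (dashv x y) z = vdash (vdash x y) z"
      and "dashv x (vdash y z) = dashv x (dashv y z)"
      using p q r by (simp_all add: simps)
    \<comment> \<open>Expanding \<open>L (free_M q) (p * letter (free_M r))\<close> by
      \<open>L_mult_letter\<close> makes the representatives of both sides equal.\<close>
    show "tensor_add scale (dashv (dashv x y) z) (tensor_scale scale (- 1) (dashv x (dashv y z))) =
      tensor_add scale (dashv (vdash y x) z) (tensor_scale scale (- 1) (vdash y (dashv x z)))"
      using p q r by (simp add: simps L_mult_letter algebra_simps)
    let ?m = "free_M p" and ?n = "free_M q"
    \<comment> \<open>The two associators differ by the negative of the element in
      \<open>L_commutator\<close>.\<close>
    have "L (?m \<circ>\<^sub>A ?n) r - L ?m (L ?n r) - (L (?n \<circ>\<^sub>A ?m) r - L ?n (L ?m r)) =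
      - (L ?m (L ?n r) - L ?n (L ?m r) - L (?m \<circ>\<^sub>A ?n) r + L (?n \<circ>\<^sub>A ?m) r)"
      by simp
    then have "L (?m \<circ>\<^sub>A ?n) r - L ?m (L ?n r) - (L (?n \<circ>\<^sub>A ?m) r - L ?n (L ?m r)) \<in> relator_ideal scale"
      using free.subspace_neg[OF subspace_relator_ideal] L_commutator by metis
    then have "cl (L (?m \<circ>\<^sub>A ?n) r - L ?m (L ?n r)) = cl (L (?n \<circ>\<^sub>A ?m) r - L ?n (L ?m r))"
      by (intro tensor_class_eqI free_space_diff L_in_free_space)
    then show "tensor_add scale (vdash (vdash x y) z) (tensor_scale scale (- 1) (vdash x (vdash y z))) =
      tensor_add scale (vdash (vdash y x) z) (tensor_scale scale (- 1) (vdash y (vdash x z)))"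
      using p q r by (simp add: simps)
  qed
qed

end

theorem proposition1:
  fixes scale :: "'k::field \<Rightarrow> 'a::ab_group_add \<Rightarrow> 'a"
    and circ :: "'a \<Rightarrow> 'a \<Rightarrow> 'a"
  assumes "left_symmetric_algebra scale circ"
  shows "(\<exists>M vdash dashv. tensor_operations scale circ M vdash dashv) \<and>
    (\<forall>M vdash dashv. tensor_operations scale circ M vdash dashv \<longrightarrow>
      left_symmetric_dialgebra (tensor_space scale) (tensor_add scale) (tensor_zero scale)
        (tensor_scale scale) vdash dashv)"
proof -
  interpret left_symmetric_algebra scale circ by fact
  show ?thesis
    using tensor_operations_exist left_symmetric_dialgebra_tensor_operations by blast
qed

end
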